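(* For every positive integer $n$, the number of distinct $x$-ray lists (with zero entries omitted) arising from partitions of $n$ equals the number of partitions of $n$ into distinct parts.
   Context: For a partition $\lambda$ with $\ell(\lambda)$ parts, let $m=\max\{\lambda_1,\ell(\lambda)\}$ and let the Ferrers matrix of $\lambda$ be the $m\times m$ $0/1$ matrix whose $(i,j)$ entry is $1$ if $(i,j)$ is a cell of the Young diagram of $\lambda$ (i.e. $j\le\lambda_i$) and $0$ otherwise. The $x$-ray list $\lambda_x$ is the sequence $(s_2,s_3,\dots,s_{2m})$ where $s_k$ is the sum of the entries $(i,j)$ of the Ferrers matrix with $i+j=k$. Two $x$-ray lists are regarded as the same if they agree after deleting all zero entries. *)

theory Defs
  imports "Jordan_Normal_Form.Matrix"
begin

text \<open>A partition is the weakly decreasing list of its (positive) parts.\<close>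

definition partitions_of :: "nat \<Rightarrow> nat list set" where
  "partitions_of n = {l. sorted_wrt (\<ge>) l \<and> 0 \<notin> set l \<and> sum_list l = n}"

definition distinct_partitions_of :: "nat \<Rightarrow> nat list set" where
  "distinct_partitions_of n = {l \<in> partitions_of n. distinct l}"

text \<open>\<open>part l i\<close> is the \<open>i\<close>-th part, counted from 1, and 0 beyond the last part.\<close>

definition part :: "nat list \<Rightarrow> nat \<Rightarrow> nat" where
  "part l i = (if 1 \<le> i \<and> i \<le> length l then l ! (i - 1) else 0)"

definition young_diagram :: "nat list \<Rightarrow> (nat \<times> nat) set" where
  "young_diagram l = {(i, j). 1 \<le> i \<and> i \<le> length l \<and> 1 \<le> j \<and> j \<le> part l i}"

definition ferrers_size :: "nat list \<Rightarrow> nat" where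
  "ferrers_size l = max (part l 1) (length l)"

text \<open>Cells and the index \<open>k\<close> below are 1-based, whereas the library's matrices are indexed
  from 0: the entry of the Ferrers matrix in row \<open>i\<close> and column \<open>j\<close> is at \<open>(i - 1, j - 1)\<close>.\<close>

definition ferrers_matrix :: "nat list \<Rightarrow> nat mat" where
  "ferrers_matrix l = mat (ferrers_size l) (ferrers_size l)
     (\<lambda>(i, j). if (i + 1, j + 1) \<in> young_diagram l then 1 else 0)"

definition x_ray :: "nat list \<Rightarrow> nat \<Rightarrow> nat" where
  "x_ray l k = (\<Sum>(i, j) \<in> {(i, j). i \<in> {1..ferrers_size l} \<and> j \<in> {1..ferrers_size l} \<and> i + j = k}.
     ferrers_matrix l $$ (i - 1, j - 1))"

definition x_ray_list :: "nat list \<Rightarrow> nat list" where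
  "x_ray_list l = map (x_ray l) [2..<2 * ferrers_size l + 1]"

definition omit_zeros :: "nat list \<Rightarrow> nat list" where
  "omit_zeros s = filter (\<lambda>x. x \<noteq> 0) s"

end

theory Submission
  imports Defs
begin

text \<open>Let \<open>d k\<close> be the number of cells on the antidiagonal \<open>i + j = k\<close>. An antidiagonal that is not
  full is followed by one with at most as many cells. Hence pushing the cells of every antidiagonal
  into the top rows, that is, passing to \<open>{(i, j). i \<le> d (i + j)}\<close>, again gives a Young diagram, with
  the same x-ray. The diagrams fixed by this operation are exactly those with distinct row lengths,
  so every x-ray arises from exactly one partition into distinct parts.\<close>

section \<open>Antidiagonals of Young diagrams\<close>

text \<open>An antidiagonal is recorded by its row indices, so that it is a set of naturals;
  \<open>i < k\<close> keeps \<open>k - i\<close> from being truncated.\<close>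

definition antidiagonal :: "(nat \<times> nat) set \<Rightarrow> nat \<Rightarrow> nat set" where
  "antidiagonal D k = {i. i < k \<and> (i, k - i) \<in> D}"

definition diag_count :: "nat list \<Rightarrow> nat \<Rightarrow> nat" where
  "diag_count l k = card (antidiagonal (young_diagram l) k)"

lemma finite_antidiagonal [simp]: "finite (antidiagonal D k)"
  by (rule finite_subset[of _ "{..<k}"]) (auto simp: antidiagonal_def)

lemma mem_young_diagram: "(i, j) \<in> young_diagram l \<longleftrightarrow> 1 \<le> i \<and> 1 \<le> j \<and> j \<le> part l i"
  by (auto simp: young_diagram_def part_def)

lemma part_antimono:
  assumes "sorted_wrt (\<ge>) l" "1 \<le> i" "i \<le> i'"
  shows "part l i' \<le> part l i"
proof (cases "i' = i")
  case False
  then show ?thesis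
    using assms sorted_wrt_nth_less[OF assms(1), of "i - 1" "i' - 1"]
    by (auto simp: part_def)
qed simp

lemma young_diagram_down_closed:
  assumes "sorted_wrt (\<ge>) l" "(i', j') \<in> young_diagram l" "1 \<le> i" "i \<le> i'" "1 \<le> j" "j \<le> j'"
  shows "(i, j) \<in> young_diagram l"
  using part_antimono[OF assms(1,3,4)] assms by (auto simp: mem_young_diagram)

lemma young_diagram_eq_Sigma: "young_diagram l = (SIGMA i:{1..length l}. {1..part l i})"
  by (auto simp: young_diagram_def)

lemma card_young_diagram: "card (young_diagram l) = sum_list l"
proof -
  have "card (young_diagram l) = (\<Sum>i\<in>{1..length l}. part l i)"
    by (simp add: young_diagram_eq_Sigma)
  also have "\<dots> = (\<Sum>i<length l. l ! i)"
    by (rule sum.reindex_bij_witness[of _ Suc "\<lambda>i. i - 1"]) (auto simp: part_def)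
  also have "\<dots> = sum_list l"
    by (simp add: sum_list_sum_nth atLeast0LessThan)
  finally show ?thesis .
qed

lemma young_diagram_le_ferrers_size:
  assumes "sorted_wrt (\<ge>) l" "(i, j) \<in> young_diagram l"
  shows "i \<le> ferrers_size l" "j \<le> ferrers_size l"
  using part_antimono[OF assms(1), of 1 i] assms(2)
  by (auto simp: ferrers_size_def young_diagram_def)

lemma antidiagonal_young_subset: "antidiagonal (young_diagram l) k \<subseteq> {1..<k}"
  by (auto simp: antidiagonal_def mem_young_diagram)

lemma diag_count_le: "diag_count l k \<le> k - 1"
  using card_mono[OF _ antidiagonal_young_subset[of l k]] by (simp add: diag_count_def)

lemma diag_count_Suc_le:
  assumes "sorted_wrt (\<ge>) l" "diag_count l k < k - 1"
  shows "diag_count l (Suc k) \<le> diag_count l k"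
proof -
  let ?R = "antidiagonal (young_diagram l)"
  \<comment> \<open>There are \<open>k - 1\<close> positions available, so a smaller count leaves
    one of them empty.\<close>
  have "?R k \<noteq> {1..<k}"
    using assms(2) by (auto simp: diag_count_def)
  then obtain h where h: "h \<in> {1..<k}" "h \<notin> ?R k"
    using antidiagonal_young_subset[of l k] by blast
  text \<open>Rows above the missing cell move left, rows below it move up.\<close>
  define f where "f i = (if i \<le> h then i else i - 1)" for i
  have f_mem: "f i \<in> ?R k" if "i \<in> ?R (Suc k)" for i
  proof -
    have i: "1 \<le> i" "i \<le> k" "(i, Suc k - i) \<in> young_diagram l"
      using that antidiagonal_young_subset[of l "Suc k"] by (auto simp: antidiagonal_def)
    show ?thesis
      unfolding f_def antidiagonal_def
      using h(1) i young_diagram_down_closed[OF assms(1) i(3), of "f i" "k - f i"]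
      by (auto simp: f_def split: if_splits)
  qed
  have "inj_on f (?R (Suc k))"
  proof (rule inj_onI)
    fix x y assume xy: "x \<in> ?R (Suc k)" "y \<in> ?R (Suc k)" "f x = f y"
    have "f x \<noteq> h" "f y \<noteq> h"
      \<comment> \<open>\<open>f\<close> can only merge rows \<open>h\<close> and
        \<open>h + 1\<close>, both sent to \<open>h\<close>, and \<open>h\<close> lies outside
        \<open>?R k\<close>.\<close>
      using f_mem[OF xy(1)] f_mem[OF xy(2)] h(2) by metis+
    then show "x = y"
      using xy(3) by (auto simp: f_def split: if_splits)
  qed
  then show ?thesis
    unfolding diag_count_def by (rule card_inj_on_le) (use f_mem in auto)
qed

text \<open>Either antidiagonal \<open>k\<close> is full, with \<open>k - 1\<close> cells, or the
  counts do not increase. Hence each set \<open>{k. i \<le> diag_count l k}\<close> is closed under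
  predecessors down to \<open>i + 1\<close>.\<close>

lemma le_diag_count_if_le_Suc:
  assumes "sorted_wrt (\<ge>) l" "i < k" "i \<le> diag_count l (Suc k)"
  shows "i \<le> diag_count l k"
  using diag_count_Suc_le[OF assms(1), of k] assms(2,3) by linarith

lemma diag_count_eq_0:
  assumes "sorted_wrt (\<ge>) l" "2 * ferrers_size l < k"
  shows "diag_count l k = 0"
proof -
  have "antidiagonal (young_diagram l) k = {}"
    using young_diagram_le_ferrers_size[OF assms(1)] assms(2)
    by (fastforce simp: antidiagonal_def)
  then show ?thesis by (simp add: diag_count_def)
qed

text \<open>A free bound \<open>N\<close> lets partitions with different Ferrers sizes be compared
  over one range.\<close>

lemma sum_list_eq_sum_diag_count:
  assumes "sorted_wrt (\<ge>) l" "2 * ferrers_size l \<le> N"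
  shows "sum_list l = (\<Sum>k\<le>N. diag_count l k)"
proof -
  have "bij_betw (\<lambda>(k, i). (i, k - i)) (SIGMA k:{..N}. antidiagonal (young_diagram l) k)
      (young_diagram l)"
    using young_diagram_le_ferrers_size[OF assms(1)] assms(2)
    by (intro bij_betw_byWitness[where f' = "\<lambda>(i, j). (i + j, i)"])
       (fastforce simp: antidiagonal_def mem_young_diagram)+
  then show ?thesis
    by (simp add: bij_betw_same_card[symmetric] card_young_diagram[symmetric] diag_count_def)
qed

section \<open>The x-ray list determines the antidiagonal counts\<close>

lemma x_ray_eq_diag_count:
  assumes "sorted_wrt (\<ge>) l"
  shows "x_ray l k = diag_count l k"
proof -
  let ?m = "ferrers_size l"
  let ?A = "{(i, j). i \<in> {1..?m} \<and> j \<in> {1..?m} \<and> i + j = k}"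
  have fin: "finite ?A"
    by (rule finite_subset[of _ "{1..?m} \<times> {1..?m}"]) auto
  have "x_ray l k = (\<Sum>c\<in>?A. if c \<in> young_diagram l then 1 else 0)"
    unfolding x_ray_def by (rule sum.cong) (auto simp: ferrers_matrix_def)
  also have "\<dots> = card (?A \<inter> young_diagram l)"
    using fin by (simp add: sum.If_cases Int_def)
  also have "\<dots> = diag_count l k"
    unfolding diag_count_def
    by (rule bij_betw_same_card[of fst], rule bij_betw_byWitness[where f' = "\<lambda>i. (i, k - i)"])
       (use young_diagram_le_ferrers_size[OF assms] in
         \<open>auto simp: antidiagonal_def mem_young_diagram\<close>)
  finally show ?thesis .
qed

lemma diag_count_nonzero_subset:
  assumes "sorted_wrt (\<ge>) l"
  shows "{k. diag_count l k \<noteq> 0} \<subseteq> {2..2 * ferrers_size l}"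
proof
  fix k assume k: "k \<in> {k. diag_count l k \<noteq> 0}"
  then have "2 \<le> k"
    using diag_count_le[of l k] by simp
  moreover have "k \<le> 2 * ferrers_size l"
    using k diag_count_eq_0[OF assms] by (metis mem_Collect_eq not_le)
  ultimately show "k \<in> {2..2 * ferrers_size l}" by simp
qed

text \<open>Every nonzero count has its index in the listed range, so the right-hand side depends on
  \<open>diag_count l\<close> alone and no longer on \<open>ferrers_size l\<close>.\<close>

lemma omit_zeros_x_ray_list:
  assumes "sorted_wrt (\<ge>) l"
  shows "omit_zeros (x_ray_list l)
    = map (diag_count l) (sorted_list_of_set {k. diag_count l k \<noteq> 0})"
proof -
  let ?ks = "filter (\<lambda>k. diag_count l k \<noteq> 0) [2..<2 * ferrers_size l + 1]"
  have "set ?ks = {k. diag_count l k \<noteq> 0}"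
    using diag_count_nonzero_subset[OF assms] by auto
  then have "?ks = sorted_list_of_set {k. diag_count l k \<noteq> 0}"
    by (metis distinct_filter distinct_upt sorted_upt sorted_wrt_filter
        sorted_list_of_set.idem_if_sorted_distinct)
  then show ?thesis
    by (simp add: omit_zeros_def x_ray_list_def filter_map o_def x_ray_eq_diag_count[OF assms])
qed

lemma mem_of_Suc_closed:
  fixes S :: "nat set"
  assumes "\<And>k. b \<le> k \<Longrightarrow> Suc k \<in> S \<Longrightarrow> k \<in> S" "y \<in> S" "b \<le> x" "x \<le> y"
  shows "x \<in> S"
  using assms(4,2)
proof (induction rule: inc_induct)
  case (step m)
  then show ?case
    using assms(1)[of m] assms(3) by simp
qed

text \<open>Two initial segments of \<open>{b..}\<close> are comparable by inclusion, and finite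
  comparable sets of equal size coincide.\<close>

lemma initial_segment_eqI:
  fixes S T :: "nat set"
  assumes "finite S" "finite T" "card S = card T" "S \<subseteq> {b..}" "T \<subseteq> {b..}"
    and S: "\<And>k. b \<le> k \<Longrightarrow> Suc k \<in> S \<Longrightarrow> k \<in> S"
    and T: "\<And>k. b \<le> k \<Longrightarrow> Suc k \<in> T \<Longrightarrow> k \<in> T"
  shows "S = T"
proof -
  have "S \<subseteq> T \<or> T \<subseteq> S"
  proof (rule ccontr)
    assume "\<not> (S \<subseteq> T \<or> T \<subseteq> S)"
    then obtain x y where "x \<in> S" "x \<notin> T" "y \<in> T" "y \<notin> S" by blast
    moreover have "x \<le> y \<or> y \<le> x" by linarith
    ultimately show False
      using mem_of_Suc_closed[of b S x y] mem_of_Suc_closed[of b T y x] S T assms(4,5) by auto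
  qed
  then show ?thesis
    using card_subset_eq assms(1-3) by metis
qed

text \<open>The indices with nonzero count form an interval starting at 2, if there are any. The
  length of the reduced list therefore recovers them, and its entries recover the counts.\<close>

lemma omit_zeros_x_ray_list_eq_iff:
  assumes "sorted_wrt (\<ge>) l" "sorted_wrt (\<ge>) l'"
  shows "omit_zeros (x_ray_list l) = omit_zeros (x_ray_list l') \<longleftrightarrow> diag_count l = diag_count l'"
proof
  let ?S = "\<lambda>l. {k. diag_count l k \<noteq> 0}"
  have fin: "finite (?S l)" "finite (?S l')"
    using diag_count_nonzero_subset assms by (meson finite_atLeastAtMost finite_subset)+
  have sub: "?S l \<subseteq> {2..}" "?S l' \<subseteq> {2..}"
    using diag_count_nonzero_subset assms by fastforce+
  have closed: "k \<in> ?S p" if "sorted_wrt (\<ge>) p" "2 \<le> k" "Suc k \<in> ?S p" for p k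
    using le_diag_count_if_le_Suc[OF that(1), of 1 k] that(2,3) by simp
  assume "omit_zeros (x_ray_list l) = omit_zeros (x_ray_list l')"
  then have eq: "map (diag_count l) (sorted_list_of_set (?S l))
      = map (diag_count l') (sorted_list_of_set (?S l'))"
    by (simp only: omit_zeros_x_ray_list assms)
  then have "card (?S l) = card (?S l')"
    by (metis length_map length_sorted_list_of_set)
  then have S: "?S l = ?S l'"
    by (intro initial_segment_eqI[where b = 2] fin sub) (use closed assms in blast)+
  then have "diag_count l k = diag_count l' k" if "k \<in> ?S l" for k
    using eq that fin by simp
  moreover have "diag_count l k = diag_count l' k" if "k \<notin> ?S l" for k
    using that that[unfolded S] by simp
  ultimately show "diag_count l = diag_count l'"
    by blast
qed (simp add: omit_zeros_x_ray_list assms)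

section \<open>Partitions into distinct parts\<close>

lemma strict_sorted_iff_distinct: "sorted_wrt (>) l \<longleftrightarrow> sorted_wrt (\<ge>) l \<and> distinct l"
  for l :: "nat list"
  by (induction l) (auto simp: order.strict_iff_order)

text \<open>If rows strictly decrease, a cell forces its upper right neighbour, on the same
  antidiagonal, to be a cell too. Each antidiagonal thus fills its top rows, and the counts
  determine the diagram.\<close>

lemma young_diagram_strict:
  assumes "sorted_wrt (>) l"
  shows "young_diagram l = {(i, j). 1 \<le> i \<and> 1 \<le> j \<and> i \<le> diag_count l (i + j)}"
proof -
  have up: "(i, Suc j) \<in> young_diagram l" if "1 \<le> i" "(Suc i, j) \<in> young_diagram l" for i j
    using that sorted_wrt_nth_less[OF assms, of "i - 1" i] by (auto simp: young_diagram_def part_def)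
  have R: "antidiagonal (young_diagram l) k = {1..diag_count l k}" for k
  proof (rule initial_segment_eqI[where b = 1])
    fix i assume "1 \<le> i" "Suc i \<in> antidiagonal (young_diagram l) k"
    then show "i \<in> antidiagonal (young_diagram l) k"
      using up[of i "k - Suc i"] by (auto simp: antidiagonal_def Suc_diff_Suc)
  qed (use antidiagonal_young_subset[of l k] in \<open>auto simp: diag_count_def\<close>)
  have "(i, j) \<in> young_diagram l \<longleftrightarrow> 1 \<le> j \<and> i \<in> antidiagonal (young_diagram l) (i + j)" for i j
    by (auto simp: antidiagonal_def mem_young_diagram)
  then show ?thesis
    unfolding R by auto
qed

text \<open>The diagram gives all row lengths; as no part is 0, the positive ones also give the
  length of the list.\<close>

lemma partition_eqI:
  assumes "0 \<notin> set l" "0 \<notin> set l'" "young_diagram l = young_diagram l'"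
  shows "l = l'"
proof -
  have eq: "part l i = part l' i" if "1 \<le> i" for i
  proof -
    have "{j. (i, j) \<in> young_diagram p} = {1..part p i}" for p
      using that by (auto simp: mem_young_diagram)
    then have "{1..part l i} = {1..part l' i}"
      using assms(3) by metis
    then show ?thesis
      by (metis card_atLeastAtMost diff_Suc_1)
  qed
  have pos: "i < length p \<longleftrightarrow> 0 < part p (Suc i)" if "0 \<notin> set p" for p i
    using that by (auto simp: part_def Suc_le_eq) (metis gr0I nth_mem)
  have len: "i < length l \<longleftrightarrow> i < length l'" for i
    using pos assms(1,2) eq[of "Suc i"] by simp
  then have "length l = length l'"
    by (metis less_irrefl linorder_neqE_nat)
  moreover have "l ! i = l' ! i" if "i < length l" for i
    using eq[of "Suc i"] that len[of i] by (simp add: part_def Suc_le_eq)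
  ultimately show ?thesis
    by (rule nth_equalityI)
qed

lemma ex_partition_with_parts:
  fixes a :: "nat \<Rightarrow> nat"
  assumes dec: "\<And>i. 1 \<le> i \<Longrightarrow> a (Suc i) \<noteq> 0 \<Longrightarrow> a (Suc i) < a i" and "a (Suc N) = 0"
  obtains l where "sorted_wrt (>) l" "0 \<notin> set l" "\<And>i. 1 \<le> i \<Longrightarrow> part l i = a i"
proof -
  define r where "r = (LEAST i. a (Suc i) = 0)"
  define l where "l = map (\<lambda>i. a (Suc i)) [0..<r]"
  have r: "a (Suc r) = 0"
    unfolding r_def by (rule LeastI) (rule assms(2))
  have pos: "a (Suc i) \<noteq> 0" if "i < r" for i
    using not_less_Least[of i "\<lambda>i. a (Suc i) = 0"] that by (simp add: r_def)
  \<comment> \<open>A zero persists, since a nonzero successor would have to lie below 0.\<close>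
  have zero: "a (Suc i) = 0" if "r \<le> i" for i
    using that by (induction rule: dec_induct) (use r dec in force)+
  show ?thesis
  proof
    show "sorted_wrt (>) l"
      unfolding l_def by (subst sorted_wrt_iff_nth_Suc_transp) (use dec pos in auto)
    show "0 \<notin> set l"
      using pos by (force simp: l_def)
    show "part l i = a i" if "1 \<le> i" for i
      using that zero[of "i - 1"] by (auto simp: part_def l_def)
  qed
qed

lemma ex_strict_partition_same_diag_count:
  assumes l: "sorted_wrt (\<ge>) l"
  obtains l' where "sorted_wrt (>) l'" "0 \<notin> set l'" "diag_count l' = diag_count l"
proof -
  let ?d = "diag_count l" and ?N = "2 * ferrers_size l"
  \<comment> \<open>\<open>a i\<close> is the length of row \<open>i\<close> of the pushed diagram:
    the cell \<open>(i, a i + 1)\<close> is the first one missing there.\<close>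
  define a where "a i = (LEAST j. ?d (i + Suc j) < i)" for i
  have ex: "?d (i + Suc ?N) < i" if "1 \<le> i" for i
    using that diag_count_eq_0[OF l, of "i + Suc ?N"] by simp
  have a: "j \<le> a i \<longleftrightarrow> i \<le> ?d (i + j)" if "1 \<le> i" "1 \<le> j" for i j
  proof
    assume "j \<le> a i"
    then have "j - 1 < a i"
      using that by simp
    from not_less_Least[OF this[unfolded a_def]] show "i \<le> ?d (i + j)"
      using that by simp
  next
    assume ij: "i \<le> ?d (i + j)"
    show "j \<le> a i"
    proof (rule ccontr)
      assume "\<not> j \<le> a i"
      then have le: "i + Suc (a i) \<le> i + j"
        by simp
      \<comment> \<open>Row \<open>i\<close> has no gaps: a cell in column \<open>j > a i\<close>
        would, by closure under predecessors, put the first missing cell into the diagram.\<close>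
      have "i + Suc (a i) \<in> {k. i \<le> ?d k}"
      proof (rule mem_of_Suc_closed[OF _ _ _ le])
        show "k \<in> {k. i \<le> ?d k}" if "Suc i \<le> k" "Suc k \<in> {k. i \<le> ?d k}" for k
          using le_diag_count_if_le_Suc[OF l, of i k] that by simp
      qed (use ij in simp_all)
      moreover have "?d (i + Suc (a i)) < i"
        unfolding a_def by (rule LeastI) (rule ex[OF that(1)])
      ultimately show False by simp
    qed
  qed
  \<comment> \<open>The last cell of row \<open>i + 1\<close> has its upper right neighbour on the
    same antidiagonal, so row \<open>i\<close> reaches one column further.\<close>
  have dec: "a (Suc i) < a i" if "1 \<le> i" "a (Suc i) \<noteq> 0" for i
    using a[of "Suc i" "a (Suc i)"] a[of i "Suc (a (Suc i))"] that by (simp add: Suc_le_eq)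
  have "a (Suc ?N) = 0"
    using a[of "Suc ?N" 1] diag_count_eq_0[OF l, of "Suc ?N + 1"] by simp
  then obtain l' where l': "sorted_wrt (>) l'" "0 \<notin> set l'" "\<And>i. 1 \<le> i \<Longrightarrow> part l' i = a i"
    using ex_partition_with_parts[of a ?N] dec by blast
  \<comment> \<open>The bound \<open>?d k \<le> k - 1\<close> ensures that the rows up to
    \<open>?d k\<close> all meet antidiagonal \<open>k\<close>.\<close>
  have "antidiagonal (young_diagram l') k = {1..?d k}" for k
    using diag_count_le[of l k] l'(3) a by (auto simp: antidiagonal_def mem_young_diagram)
  then have "diag_count l' = ?d"
    by (auto simp: diag_count_def)
  with l' show thesis using that by blast
qed

lemma sum_list_eq_of_diag_count_eq:
  assumes "sorted_wrt (\<ge>) l" "sorted_wrt (\<ge>) l'" "diag_count l = diag_count l'"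
  shows "sum_list l = sum_list l'"
  using assms sum_list_eq_sum_diag_count[of _ "2 * max (ferrers_size l) (ferrers_size l')"]
  by simp

theorem theorem6p4:
  fixes n :: nat
  assumes "n > 0"
  shows "card ((\<lambda>l. omit_zeros (x_ray_list l)) ` partitions_of n)
       = card (distinct_partitions_of n)"
proof -
  let ?f = "\<lambda>l. omit_zeros (x_ray_list l)"
  \<comment> \<open>Pushing up keeps the counts, hence both the x-ray list and the size
    \<open>n\<close>.\<close>
  have "?f ` partitions_of n \<subseteq> ?f ` distinct_partitions_of n"
  proof (rule image_subsetI)
    fix l assume "l \<in> partitions_of n"
    then have l: "sorted_wrt (\<ge>) l" "sum_list l = n"
      by (auto simp: partitions_of_def)
    obtain l' where l': "sorted_wrt (>) l'" "0 \<notin> set l'" "diag_count l' = diag_count l"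
      using ex_strict_partition_same_diag_count[OF l(1)] by blast
    then have s: "sorted_wrt (\<ge>) l'" "distinct l'"
      by (auto simp: strict_sorted_iff_distinct)
    then have "l' \<in> distinct_partitions_of n"
      using l'(2) l(2) sum_list_eq_of_diag_count_eq[OF s(1) l(1) l'(3)]
      by (auto simp: distinct_partitions_of_def partitions_of_def)
    moreover have "?f l = ?f l'"
      using omit_zeros_x_ray_list_eq_iff[OF l(1) s(1)] l'(3) by simp
    ultimately show "?f l \<in> ?f ` distinct_partitions_of n" by blast
  qed
  moreover have "distinct_partitions_of n \<subseteq> partitions_of n"
    by (auto simp: distinct_partitions_of_def)
  ultimately have "?f ` partitions_of n = ?f ` distinct_partitions_of n"
    by blast
  \<comment> \<open>The reduced list fixes the counts, these fix the diagram of a strict partition,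
    and the diagram fixes its parts.\<close>
  moreover have "inj_on ?f (distinct_partitions_of n)"
  proof (rule inj_onI)
    fix l l' assume *: "l \<in> distinct_partitions_of n" "l' \<in> distinct_partitions_of n" "?f l = ?f l'"
    then have s: "sorted_wrt (\<ge>) l" "sorted_wrt (\<ge>) l'" "sorted_wrt (>) l" "sorted_wrt (>) l'"
        "0 \<notin> set l" "0 \<notin> set l'"
      by (auto simp: strict_sorted_iff_distinct distinct_partitions_of_def partitions_of_def)
    have "diag_count l = diag_count l'"
      using *(3) omit_zeros_x_ray_list_eq_iff[OF s(1,2)] by simp
    then have "young_diagram l = young_diagram l'"
      by (simp only: young_diagram_strict[OF s(3)] young_diagram_strict[OF s(4)])
    then show "l = l'"
      by (rule partition_eqI[OF s(5,6)])
  qed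
  ultimately show ?thesis
    by (simp add: card_image)
qed

end
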